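(* Let $n\ge 0$ be an integer and let $q,a,b$ be nonzero complex parameters such that no denominator occurring below vanishes. Then $$ {}_4\phi_3\left[\begin{array}{c} q^{-2n},\, a,\, b,\, q^{3-2n}/ab \\ q^{2-2n}/a,\, q^{4-2n}/b,\, abq\end{array};q^2,\,q^2\right] =\frac{(a,-q;q)_n\,(b;q)_{n-1}\,(ab;q^2)_{n-1}\,\bigl(abq^{2n-2}(b-q^2)+abq^{n-1}(q-1)+q-b\bigr)} {q^{n+1}(1-abq^{2n-1})\,(ab;q)_{n-1}\,(a,b/q^2;q^2)_n}. $$
   Context: For an integer $n\ge 0$, $(x;q)_n=\prod_{i=0}^{n-1}(1-xq^i)$ (so $(x;q)_0=1$), and $(x_1,\ldots,x_m;q)_n=\prod_{i=1}^m (x_i;q)_n$; $(x;q^2)_n$ is the same with $q$ replaced by $q^2$. For index $-1$ (occurring only when $n=0$) the usual convention is $(x;q)_{-1}=1/(1-xq^{-1})$ and $(x;q^2)_{-1}=1/(1-xq^{-2})$. The basic hypergeometric series is $${}_4\phi_3\left[\begin{array}{c} a_1,a_2,a_3,a_4\\ b_1,b_2,b_3\end{array};q,z\right]=\sum_{k\ge 0}\frac{(a_1,a_2,a_3,a_4;q)_k\,z^k}{(q,b_1,b_2,b_3;q)_k}.$$ In the claim the base is $q^2$ (replace $q$ by $q^2$ in the definition) and $a_1=q^{-2n}$, so the series terminates: it denotes the finite sum over $0\le k\le n$. Here $q^{c}/ab$ means $q^{c}/(ab)$. The identity is to be understood as an identity of rational functions in $a,b,q$, i.e. valid whenever no denominator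 vanishes. *)

theory Defs
  imports Complex_Main
begin

(* For a negative index this is the usual extension (x;q)_{-m} = 1 / ((1 - x/q) ... (1 - x/q^m)). *)
definition qpoch :: "complex \<Rightarrow> complex \<Rightarrow> int \<Rightarrow> complex" where
  "qpoch x q n =
     (if n \<ge> 0 then \<Prod>i<nat n. (1 - x * q ^ i)
      else 1 / (\<Prod>i=1..nat (- n). (1 - x / q ^ i)))"

definition qpochs :: "complex list \<Rightarrow> complex \<Rightarrow> int \<Rightarrow> complex" where
  "qpochs xs q n = (\<Prod>x\<leftarrow>xs. qpoch x q n)"

(* If some upper parameter is q^(-N) with q \<noteq> 0, every term with k > N has numerator 0, hence is 0
   (also when its denominator vanishes, as 0 / 0 = 0), and the series is the finite sum over k \<le> N. *)
definition phi43 ::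
  "complex \<Rightarrow> complex \<Rightarrow> complex \<Rightarrow> complex \<Rightarrow> complex \<Rightarrow> complex \<Rightarrow> complex \<Rightarrow> complex \<Rightarrow> complex \<Rightarrow> complex"
  where
  "phi43 a1 a2 a3 a4 b1 b2 b3 q z =
     (\<Sum>k. qpochs [a1, a2, a3, a4] q (int k) * z ^ k / qpochs [q, b1, b2, b3] q (int k))"

end

theory Submission
  imports Defs
begin

text \<open>
  Write \<open>p = q\<^sup>2\<close> and let \<open>A\<^sub>k = (a, b; p)\<^sub>k / (p, abq; p)\<^sub>k\<close> be the coefficients of
  \<open>F(x) = \<^sub>2\<phi>\<^sub>1(a, b; abq; p, x)\<close>. The proof rests on a product formula of Clausen type for
  \<open>F(x) F(qx)\<close>, whose coefficients are \<open>N\<^sub>n = \<Sum>\<^sub>k q\<^sup>k A\<^sub>k A\<^bsub>n-k\<^esub>\<close>: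
  \<open>N\<^sub>n = (a, b; q)\<^sub>n (ab; p)\<^sub>n / ((q, ab; q)\<^sub>n (abq; p)\<^sub>n)\<close> (lemma \<open>clausen_conv_closed_form\<close>).

  This formula comes from creative telescoping. The reflection \<open>k \<mapsto> n - k\<close> shows that the weights
  \<open>q\<^sup>k\<close> and \<open>q\<^bsup>n-k\<^esup>\<close> give the same sum \<open>N\<^sub>n\<close>. A suitable combination of
  these two forms of \<open>N\<^sub>n\<close> and of the two forms of \<open>N\<^bsub>n+1\<^esub>\<close> has a summand that is a
  difference \<open>G\<^sub>k - G\<^bsub>k+1\<^esub>\<close>, and this yields a recurrence of order one
  (lemma \<open>clausen_conv_Suc\<close>).

  Let \<open>n = m + 1\<close>. Reversing the four shifted factorials whose parameters contain
  \<open>q\<^bsup>-2n\<^esup>\<close> turns the given series into a constant times a convolution of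
  \<open>A\<^sub>k q\<^bsup>-k\<^esup>\<close> with the coefficients of \<open>\<^sub>2\<phi>\<^sub>1(a, b/p; ab/q; p, x)\<close>
  (lemma \<open>phi43_eq_sum\<close>). These are, up to simple factors, \<open>A\<^bsub>m-k\<^esub>\<close>, so the series is
  contiguous to \<open>N\<^sub>m\<close>. A second telescoping expresses it as an explicit rational multiple of
  \<open>N\<^sub>m\<close> (lemma \<open>contiguous_sum\<close>), and this multiple contains the factor of the theorem that
  does not split into shifted factorials. Passing from \<open>N\<^sub>m\<close> to the series, rather than
  inducting on \<open>n\<close> for the series itself, never divides by that factor, which may vanish.
\<close>

section \<open>Shifted factorials\<close>

definition poch :: "complex \<Rightarrow> complex \<Rightarrow> nat \<Rightarrow> complex" where
  "poch x p k = (\<Prod>i<k. 1 - x * p ^ i)"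

lemma poch_0 [simp]: "poch x p 0 = 1"
  by (simp add: poch_def)

lemma poch_Suc: "poch x p (Suc k) = poch x p k * (1 - x * p ^ k)"
  by (simp add: poch_def)

lemma poch_Suc_left: "poch x p (Suc k) = (1 - x) * poch (x * p) p k"
  unfolding poch_def by (subst prod.lessThan_Suc_shift) (simp add: mult.assoc)

lemma poch_eq_0_iff: "poch x p k = 0 \<longleftrightarrow> (\<exists>i<k. x * p ^ i = 1)"
  by (auto simp: poch_def)

lemma qpoch_eq_poch: "qpoch x q (int k) = poch x q k"
  by (simp add: qpoch_def poch_def)

text \<open>The second factor consists of the last \<open>k\<close> factors of \<open>(c; p)\<^sub>n\<close>, in reverse order.\<close>
lemma poch_split:
  assumes "k \<le> n"
  shows "poch c p (n - k) * (\<Prod>i<k. 1 - c * p ^ (n - Suc i)) = poch c p n"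
  using assms
proof (induction k)
  case (Suc k)
  then have "poch c p (n - k) = poch c p (n - Suc k) * (1 - c * p ^ (n - Suc k))"
    by (simp add: Suc_diff_Suc flip: poch_Suc)
  with Suc show ?case
    by (simp add: ac_simps)
qed simp

text \<open>
  Each factor is turned around by \<open>1 - p\<^bsup>1-n+i\<^esup>/c = - (p\<^bsup>1-n+i\<^esup>/c) (1 - c p\<^bsup>n-1-i\<^esup>)\<close>.
  Apart from \<open>c\<^sup>k\<close>, the factor produced by this is the same for every \<open>c\<close>, so that it cancels
  in quotients of such products.
\<close>
lemma poch_reverse:
  assumes "k \<le> n" "c \<noteq> 0" "p \<noteq> 0"
  shows "poch (p powi (1 - int n) / c) p k * c ^ k
       = (\<Prod>i<k. - (p powi (1 - int n) * p ^ i)) * (\<Prod>i<k. 1 - c * p ^ (n - Suc i))"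
proof -
  have flip: "(1 - p powi (1 - int n) / c * p ^ i) * c
      = - (p powi (1 - int n) * p ^ i) * (1 - c * p ^ (n - Suc i))" if "i < k" for i
  proof -
    have "p powi (1 - int n) * p ^ i * p ^ (n - Suc i) = p powi (1 - int n + int i + int (n - Suc i))"
      using assms(3) by (simp add: power_int_add)
    also have "1 - int n + int i + int (n - Suc i) = 0"
      using that assms(1) by simp
    finally have "p powi (1 - int n) * p ^ i * p ^ (n - Suc i) = 1"
      by simp
    then show ?thesis
      using assms(2) by (simp add: algebra_simps)
  qed
  have "poch (p powi (1 - int n) / c) p k * c ^ k
      = (\<Prod>i<k. (1 - p powi (1 - int n) / c * p ^ i) * c)"
    by (simp add: poch_def prod.distrib)
  also have "\<dots> = (\<Prod>i<k. - (p powi (1 - int n) * p ^ i) * (1 - c * p ^ (n - Suc i)))"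
    using flip by (intro prod.cong) auto
  finally show ?thesis
    by (simp only: prod.distrib)
qed

lemma poch_square: "poch (q^2) (q^2) n = poch q q n * poch (- q) q n"
proof (induction n)
  case (Suc n)
  have "1 - q^2 * (q^2) ^ n = (1 - q * q ^ n) * (1 - (- q) * q ^ n)"
    by (simp add: algebra_simps power2_eq_square power_mult_distrib)
  with Suc show ?case
    by (simp add: poch_Suc ac_simps)
qed simp

section \<open>A product formula of Clausen type\<close>

text \<open>The coefficients of \<open>\<^sub>2\<phi>\<^sub>1(a, b; abq; q\<^sup>2, x)\<close>.\<close>
definition clausen_coeff :: "complex \<Rightarrow> complex \<Rightarrow> complex \<Rightarrow> nat \<Rightarrow> complex" where
  "clausen_coeff a b q k =
     poch a (q^2) k * poch b (q^2) k / (poch (q^2) (q^2) k * poch (a * b * q) (q^2) k)"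

text \<open>
  The coefficient of \<open>x\<^sup>n\<close> in \<open>F(x) F(qx)\<close> for \<open>F(x) = \<^sub>2\<phi>\<^sub>1(a, b; abq; q\<^sup>2, x)\<close>.
\<close>
definition clausen_conv :: "complex \<Rightarrow> complex \<Rightarrow> complex \<Rightarrow> nat \<Rightarrow> complex" where
  "clausen_conv a b q n =
     (\<Sum>k\<le>n. q ^ k * clausen_coeff a b q k * clausen_coeff a b q (n - k))"

lemma clausen_coeff_0 [simp]: "clausen_coeff a b q 0 = 1"
  by (simp add: clausen_coeff_def)

lemma clausen_coeff_Suc:
  assumes "1 - q^2 * (q^2) ^ k \<noteq> 0" "1 - a * b * q * (q^2) ^ k \<noteq> 0"
  shows "clausen_coeff a b q (Suc k) =
    clausen_coeff a b q k * ((1 - a * (q^2) ^ k) * (1 - b * (q^2) ^ k)) /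
      ((1 - q^2 * (q^2) ^ k) * (1 - a * b * q * (q^2) ^ k))"
  by (simp add: clausen_coeff_def poch_Suc ac_simps)

lemma clausen_conv_rev:
  "clausen_conv a b q n =
     (\<Sum>k\<le>n. q ^ (n - k) * clausen_coeff a b q k * clausen_coeff a b q (n - k))"
proof -
  let ?g = "\<lambda>k. q ^ k * clausen_coeff a b q k * clausen_coeff a b q (n - k)"
  have "(\<Sum>k<Suc n. ?g (Suc n - Suc k)) = (\<Sum>k<Suc n. ?g k)"
    by (rule sum.nat_diff_reindex)
  then show ?thesis
    unfolding clausen_conv_def lessThan_Suc_atMost
    by (simp add: mult.assoc mult.commute mult.left_commute)
qed

text \<open>
  Let \<open>u = q\<^bsup>2k\<^esup>\<close> and \<open>w = q\<^bsup>2n\<^esup>\<close>. The aim is to write the summand of a combination of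
  \<open>N\<^sub>n\<close> (weights \<open>\<alpha> q\<^sup>k + \<beta> q\<^bsup>n-k\<^esup>\<close>) and of \<open>N\<^bsub>n+1\<^esub>\<close> (weights
  \<open>\<gamma> q\<^sup>k + \<delta> q\<^bsup>n+1-k\<^esup>\<close>) as \<open>G\<^sub>k - G\<^bsub>k+1\<^esub>\<close>. After division by
  \<open>A\<^sub>k A\<^bsub>n-k\<^esub>\<close> and clearing of denominators this becomes an equation
  \<open>L(u) (u - q\<^sup>2 w) (u - abqw) = R(u) (u - aw) (u - bw)\<close> between polynomials in \<open>u\<close>, where \<open>L\<close> is
  quadratic and contains \<open>\<alpha>, \<beta>\<close>, and \<open>R\<close> is quadratic and contains \<open>\<gamma>, \<delta>\<close>. For generic parameters \<open>L\<close> has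
  to be proportional to \<open>(u - aw) (u - bw)\<close> and \<open>R\<close> to \<open>(u - q\<^sup>2 w) (u - abqw)\<close>; the leading
  coefficients agree, and the remaining two coefficients of each determine \<open>\<alpha>, \<beta>, \<gamma>, \<delta>\<close>.
\<close>
lemma clausen_conv_Suc:
  assumes q: "q \<noteq> 0"
    and nz: "\<And>k. k \<le> n \<Longrightarrow> 1 - q^2 * (q^2) ^ k \<noteq> 0"
            "\<And>k. k \<le> n \<Longrightarrow> 1 - a * b * q * (q^2) ^ k \<noteq> 0"
  shows "(1 - a * b * q * (q^2) ^ n) * (1 - q ^ Suc n) * (1 - a * b * q ^ n) * clausen_conv a b q (Suc n)
       = (1 - a * b * (q^2) ^ n) * (1 - a * q ^ n) * (1 - b * q ^ n) * clausen_conv a b q n"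
proof -
  define A where "A = clausen_coeff a b q"
  define x where "x = q ^ n"
  define \<alpha> where "\<alpha> = q * (1 - a * b * x^2) * (a + b) * x"
  define \<beta> where "\<beta> = - (q * (1 - a * b * x^2) * (1 + a * b * x^2))"
  define \<gamma> where "\<gamma> = - (q * (1 - a * b * q * x^2) * (q + a * b) * x)"
  define \<delta> where "\<delta> = q * (1 - a * b * q * x^2) * (1 + a * b * q * x^2)"
  define G where "G = (\<lambda>k. q ^ (Suc n - k) * (1 - (q^2) ^ k) * (q - a * b * (q^2) ^ k) * A k * A (Suc n - k))"
  define s where "s = (\<lambda>k. \<alpha> * (q ^ k * A k * A (n - k)) + \<beta> * (q ^ (n - k) * A k * A (n - k))
      + \<gamma> * (q ^ k * A k * A (Suc n - k)) + \<delta> * (q ^ (Suc n - k) * A k * A (Suc n - k)))"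
  have pow2: "(q^2) ^ k = (q ^ k)^2" for k
    by (simp add: power2_eq_square power_mult_distrib)
  have A_Suc: "A (Suc k) * ((1 - q^2 * (q^2) ^ k) * (1 - a * b * q * (q^2) ^ k)) =
      A k * ((1 - a * (q^2) ^ k) * (1 - b * (q^2) ^ k))" if "k \<le> n" for k
    using clausen_coeff_Suc[of q k a b] nz[OF that] by (simp add: A_def)
  have step: "s k = G k - G (Suc k)" if k: "k \<le> n" for k
  proof -
    define y where "y = q ^ k"
    define z where "z = q ^ (n - k)"
    have xyz: "x = y * z"
      using k by (simp add: x_def y_def z_def flip: power_add)
    have Snk: "Suc n - k = Suc (n - k)"
      using k by simp
    define D where "D = (1 - q^2 * z^2) * (1 - a * b * q * z^2)"
    have D0: "D \<noteq> 0"
      using nz[of "n - k"] by (simp add: D_def z_def pow2)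
    have r1: "A (Suc (n - k)) * D = A (n - k) * ((1 - a * z^2) * (1 - b * z^2))"
      using A_Suc[of "n - k"] by (simp add: D_def z_def pow2)
    have r2: "A (Suc k) * ((1 - q^2 * y^2) * (1 - a * b * q * y^2)) = A k * ((1 - a * y^2) * (1 - b * y^2))"
      using A_Suc[OF k] by (simp add: y_def pow2)
    have G2: "G (Suc k) = q * z * A (n - k) * (A k * ((1 - a * y^2) * (1 - b * y^2)))"
    proof -
      have "G (Suc k) = z * (1 - q^2 * y^2) * (q - a * b * (q^2 * y^2)) * A (Suc k) * A (n - k)"
        by (simp add: G_def y_def z_def pow2 power_mult_distrib mult.assoc)
      also have "\<dots> = q * z * A (n - k) * (A (Suc k) * ((1 - q^2 * y^2) * (1 - a * b * q * y^2)))"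
        by (simp add: algebra_simps power2_eq_square)
      finally show ?thesis
        by (simp only: r2)
    qed
    have G1: "G k = q * z * (1 - y^2) * (q - a * b * y^2) * A k * A (Suc (n - k))"
      by (simp add: G_def Snk y_def z_def pow2)
    have s1: "s k = \<alpha> * (y * A k * A (n - k)) + \<beta> * (z * A k * A (n - k))
      + \<gamma> * (y * A k * A (Suc (n - k))) + \<delta> * (q * z * A k * A (Suc (n - k)))"
      by (simp add: s_def Snk y_def z_def)
    have poly: "((\<alpha> * y + \<beta> * z) + q * z * ((1 - a * y^2) * (1 - b * y^2))) * D
       + (\<gamma> * y + \<delta> * (q * z) - q * z * (1 - y^2) * (q - a * b * y^2)) * ((1 - a * z^2) * (1 - b * z^2)) = 0"
      unfolding \<alpha>_def \<beta>_def \<gamma>_def \<delta>_def D_def xyz by algebra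
    have "(s k - (G k - G (Suc k))) * D =
       A k * (((\<alpha> * y + \<beta> * z) + q * z * ((1 - a * y^2) * (1 - b * y^2))) * (A (n - k) * D)
       + (\<gamma> * y + \<delta> * (q * z) - q * z * (1 - y^2) * (q - a * b * y^2)) * (A (Suc (n - k)) * D))"
      unfolding s1 G1 G2 by algebra
    also have "\<dots> = A k * A (n - k) * (((\<alpha> * y + \<beta> * z) + q * z * ((1 - a * y^2) * (1 - b * y^2))) * D
       + (\<gamma> * y + \<delta> * (q * z) - q * z * (1 - y^2) * (q - a * b * y^2)) * ((1 - a * z^2) * (1 - b * z^2)))"
      unfolding r1 by algebra
    also have "\<dots> = 0"
      unfolding poly by simp
    finally show ?thesis
      using D0 by simp
  qed
  \<comment> \<open>\<open>N\<^bsub>n+1\<^esub>\<close> has one summand more, which the boundary term of the telescoping sum cancels.\<close>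
  have last: "\<gamma> * q ^ Suc n + \<delta> = (1 - (q^2) ^ Suc n) * (q - a * b * (q^2) ^ Suc n)"
    unfolding \<gamma>_def \<delta>_def x_def pow2 power_Suc by algebra
  have "(\<Sum>k\<le>n. s k) = G 0 - G (Suc n)"
    using sum_telescope[of G n] step by (simp add: sum_telescope)
  also have "\<dots> = - ((\<gamma> * q ^ Suc n + \<delta>) * A (Suc n))"
    unfolding last by (simp add: G_def A_def)
  finally have sums: "(\<Sum>k\<le>n. s k) = \<dots>" .
  have e1: "(\<Sum>k\<le>n. q ^ k * A k * A (n - k)) = clausen_conv a b q n"
    by (simp add: clausen_conv_def A_def)
  have e2: "(\<Sum>k\<le>n. q ^ (n - k) * A k * A (n - k)) = clausen_conv a b q n"
    by (simp add: clausen_conv_rev A_def)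
  have e3: "(\<Sum>k\<le>n. q ^ k * A k * A (Suc n - k)) = clausen_conv a b q (Suc n) - q ^ Suc n * A (Suc n)"
    by (simp add: clausen_conv_def A_def)
  have e4: "(\<Sum>k\<le>n. q ^ (Suc n - k) * A k * A (Suc n - k)) = clausen_conv a b q (Suc n) - A (Suc n)"
    by (simp add: clausen_conv_rev A_def)
  have "(\<Sum>k\<le>n. s k) = (\<alpha> + \<beta>) * clausen_conv a b q n + (\<gamma> + \<delta>) * clausen_conv a b q (Suc n)
      - (\<gamma> * q ^ Suc n + \<delta>) * A (Suc n)"
    unfolding s_def sum.distrib sum_distrib_left[symmetric] e1 e2 e3 e4 by (simp add: algebra_simps)
  with sums have "(\<gamma> + \<delta>) * clausen_conv a b q (Suc n) + (\<alpha> + \<beta>) * clausen_conv a b q n = 0"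
    by (simp add: algebra_simps)
  then have "(\<gamma> + \<delta>) * clausen_conv a b q (Suc n) = - (\<alpha> + \<beta>) * clausen_conv a b q n"
    unfolding mult_minus_left by (rule eq_neg_iff_add_eq_0[THEN iffD2])
  moreover have "\<gamma> + \<delta> = q * ((1 - a * b * q * (q^2) ^ n) * (1 - q ^ Suc n) * (1 - a * b * q ^ n))"
    unfolding \<gamma>_def \<delta>_def x_def pow2 power_Suc by algebra
  moreover have "- (\<alpha> + \<beta>) = q * ((1 - a * b * (q^2) ^ n) * (1 - a * q ^ n) * (1 - b * q ^ n))"
    unfolding \<alpha>_def \<beta>_def x_def pow2 by algebra
  ultimately show ?thesis
    using q by (simp add: mult.assoc)
qed

lemma clausen_conv_closed_form:
  assumes q: "q \<noteq> 0"
    and nz: "poch (q^2) (q^2) n \<noteq> 0" "poch (a * b * q) (q^2) n \<noteq> 0" "poch (a * b) q n \<noteq> 0"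
  shows "clausen_conv a b q n =
    poch a q n * poch b q n * poch (a * b) (q^2) n / (poch q q n * poch (a * b * q) (q^2) n * poch (a * b) q n)"
  using nz
proof (induction n)
  case 0
  then show ?case by (simp add: clausen_conv_def)
next
  case (Suc n)
  have nz1: "1 - q^2 * (q^2) ^ k \<noteq> 0" if "k \<le> n" for k
    using Suc.prems(1) that by (auto simp: poch_eq_0_iff less_Suc_eq_le)
  have nz2: "1 - a * b * q * (q^2) ^ k \<noteq> 0" if "k \<le> n" for k
    using Suc.prems(2) that by (auto simp: poch_eq_0_iff less_Suc_eq_le)
  have nz3: "1 - a * b * q ^ n \<noteq> 0" "poch (a * b) q n \<noteq> 0"
    using Suc.prems(3) by (auto simp: poch_Suc)
  have nz4: "1 - q ^ Suc n \<noteq> 0"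
  proof
    assume "1 - q ^ Suc n = 0"
    then have "q ^ Suc n = 1"
      by simp
    moreover have "q^2 * (q^2) ^ n = (q ^ Suc n)^2"
      by (simp add: power_mult_distrib power2_eq_square)
    ultimately show False
      using nz1[of n] by simp
  qed
  have IH: "clausen_conv a b q n =
    poch a q n * poch b q n * poch (a * b) (q^2) n / (poch q q n * poch (a * b * q) (q^2) n * poch (a * b) q n)"
    using Suc by (simp add: poch_Suc)
  define X where "X = (1 - a * b * q * (q^2) ^ n) * (1 - q ^ Suc n) * (1 - a * b * q ^ n)"
  have X0: "X \<noteq> 0"
    using nz2[of n] nz3 nz4 by (simp add: X_def)
  have "clausen_conv a b q (Suc n) =
      (1 - a * b * (q^2) ^ n) * (1 - a * q ^ n) * (1 - b * q ^ n) * clausen_conv a b q n / X"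
    using clausen_conv_Suc[OF q nz1 nz2, of n] X0 by (simp add: X_def nonzero_eq_divide_eq ac_simps)
  also have "\<dots> = poch a q (Suc n) * poch b q (Suc n) * poch (a * b) (q^2) (Suc n) /
      (poch q q (Suc n) * poch (a * b * q) (q^2) (Suc n) * poch (a * b) q (Suc n))"
    unfolding IH X_def poch_Suc by (simp add: ac_simps)
  finally show ?case .
qed

section \<open>The contiguous sum\<close>

text \<open>
  \<open>T\<close> is the coefficient of \<open>x\<^sup>n\<close>, \<open>n = m + 1\<close>, in
  \<open>(1 - ab/q) \<^sub>2\<phi>\<^sub>1(a, b; abq; q\<^sup>2, x/q) \<^sub>2\<phi>\<^sub>1(a, b/q\<^sup>2; ab/q; q\<^sup>2, x)\<close>. The
  factor \<open>1 - ab/q\<close> keeps it meaningful for \<open>ab = q\<close>, and the summand with \<open>k = n\<close> stands apart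
  because only there the second factor contributes its constant term.

  The telescoping follows the same pattern as for \<open>clausen_conv_Suc\<close>. With \<open>u = q\<^bsup>2k\<^esup>\<close> and
  \<open>w = x\<^sup>2\<close>, the equation between summands reads
  \<open>(u - w) L(u) = (u - aw/q\<^sup>2) R(u)\<close>, where \<open>R\<close> is a cubic containing \<open>\<gamma>\<close> and \<open>L\<close> is a cubic
  containing \<open>\<alpha>, \<beta>\<close>. The condition \<open>R(w) = 0\<close> determines \<open>\<gamma>\<close>; then \<open>\<alpha>\<close> and
  \<open>\<beta>\<close> follow from \<open>L(u) = (u - aw/q\<^sup>2) R(u)/(u - w)\<close>, with \<open>\<mu>\<close> the linear coefficient of
  the quadratic \<open>R(u)/(u - w)\<close>.
\<close>
lemma contiguous_sum:
  fixes a b q :: complex and m :: nat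
  assumes q: "q \<noteq> 0"
    and nz: "\<And>k. k \<le> m \<Longrightarrow> 1 - q^2 * (q^2) ^ k \<noteq> 0"
            "\<And>k. k \<le> m \<Longrightarrow> 1 - a * b * q * (q^2) ^ k \<noteq> 0"
  defines "x \<equiv> q ^ Suc m"
  defines "T \<equiv> (1 - b / q^2) * (\<Sum>k\<le>m. clausen_coeff a b q k * clausen_coeff a b q (m - k) *
        (1 - a * (q^2) ^ (m - k)) / (1 - q^2 * (q^2) ^ (m - k)) / q ^ k)
     + (1 - a * b / q) * clausen_coeff a b q (Suc m) / x"
  shows "(1 - x) * (1 - a * b * x^2 / q) * (q * x * T)
       = (1 - a * q ^ m) * (a * b * (x / q)^2 * (b - q^2) + a * b * q ^ m * (q - 1) + q - b) * clausen_conv a b q m"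
proof -
  define A where "A = clausen_coeff a b q"
  define N where "N = clausen_conv a b q m"
  define \<gamma> where "\<gamma> = (1 - x^2) * (1 - a * b * x^2 / q)"
  define \<mu> where "\<mu> = - (1 + a * b / q) + a * b / q * x^2 * (1 - b / q^2)"
  define \<alpha> where "\<alpha> = \<mu> - a^2 * b * x^2 / q^3 + (a + b + a^2 * b^2 * x^2 / q^3) / q"
  define \<beta> where "\<beta> = b / q^2 - \<mu> * a * x^2 / q^2 - 1 / q - (a + b) * a * b * x^2 / q^4"
  define G where "G = (\<lambda>k. (1 - (q^2) ^ k) * (1 - a * b * (q^2) ^ k / q) * A k *
     ((1 - a * b * (q^2) ^ (Suc m - k) / q) * A (Suc m - k)) / q ^ k)"
  define t where "t = (\<lambda>k. A k * A (m - k) *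
        (1 - a * (q^2) ^ (m - k)) / (1 - q^2 * (q^2) ^ (m - k)) / q ^ k)"
  define s where "s = (\<lambda>k. \<gamma> * (1 - b / q^2) * t k + \<alpha> * (q ^ k * A k * A (m - k))
     + \<beta> * q / x * (q ^ (m - k) * A k * A (m - k)))"
  have pow2: "(q^2) ^ k = (q ^ k)^2" for k
    by (simp add: power2_eq_square power_mult_distrib)
  have A_Suc: "A (Suc k) * ((1 - q^2 * (q^2) ^ k) * (1 - a * b * q * (q^2) ^ k)) =
      A k * ((1 - a * (q^2) ^ k) * (1 - b * (q^2) ^ k))" if "k \<le> m" for k
    using clausen_coeff_Suc[of q k a b] nz[OF that] by (simp add: A_def)
  have step: "s k = G k - G (Suc k)" if k: "k \<le> m" for k
  proof -
    define y where "y = q ^ k"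
    define z where "z = q ^ (m - k)"
    have y0: "y \<noteq> 0" and z0: "z \<noteq> 0"
      using q by (auto simp: y_def z_def)
    have xyz: "x = q * y * z"
      using k by (simp add: x_def y_def z_def flip: power_add)
    have Smk: "Suc m - k = Suc (m - k)"
      using k by simp
    have D0: "1 - q^2 * z^2 \<noteq> 0"
      using nz(1)[of "m - k"] by (simp add: z_def pow2)
    have r1: "A (Suc (m - k)) * (1 - a * b * q * z^2)
        = A (m - k) * ((1 - a * z^2) * (1 - b * z^2)) / (1 - q^2 * z^2)"
      using A_Suc[of "m - k"] D0 by (simp add: z_def pow2 nonzero_eq_divide_eq mult.assoc ac_simps)
    have r2: "A (Suc k) * ((1 - q^2 * y^2) * (1 - a * b * q * y^2)) = A k * ((1 - a * y^2) * (1 - b * y^2))"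
      using A_Suc[OF k] by (simp add: y_def pow2)
    have div: "a * (b * (q^2 * w)) / q = a * (b * (q * w))" for w
      using q by (simp add: power2_eq_square)
    have G1: "G k = (1 - y^2) * (1 - a * b * y^2 / q) * A k *
        (A (m - k) * ((1 - a * z^2) * (1 - b * z^2)) / (1 - q^2 * z^2)) / y"
      unfolding r1[symmetric] by (simp add: G_def Smk y_def z_def pow2 power_mult_distrib div ac_simps)
    have G2: "G (Suc k) = (1 - a * b * z^2 / q) * A (m - k) * (A k * ((1 - a * y^2) * (1 - b * y^2))) / (q * y)"
      unfolding r2[symmetric] by (simp add: G_def y_def z_def pow2 power_mult_distrib div ac_simps)
    have t1: "t k = A k * A (m - k) * (1 - a * z^2) / (1 - q^2 * z^2) / y"
      by (simp add: t_def y_def z_def pow2)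
    have s1: "s k = \<gamma> * (1 - b / q^2) * t k + \<alpha> * (y * A k * A (m - k)) + \<beta> / y * (A k * A (m - k))"
      using q z0 y0 by (simp add: s_def y_def[symmetric] z_def[symmetric] xyz)
    \<comment> \<open>An identity of Laurent polynomials: \<open>1/q\<close> is replaced by a variable \<open>c\<close> with \<open>q c = 1\<close>.\<close>
    have poly: "\<gamma> * (1 - b / q^2) * (1 - a * z^2) + (\<alpha> * y^2 + \<beta>) * (1 - q^2 * z^2) =
        (1 - y^2) * (1 - a * b * y^2 / q) * ((1 - a * z^2) * (1 - b * z^2))
        - (1 - a * b * z^2 / q) * ((1 - a * y^2) * (1 - b * y^2)) / q * (1 - q^2 * z^2)"
    proof -
      define c where "c = inverse q"
      have c: "q * c = 1"
        using q by (simp add: c_def)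
      show ?thesis
        unfolding \<gamma>_def \<alpha>_def \<beta>_def \<mu>_def xyz divide_inverse inverse_mult_distrib power_inverse[symmetric] c_def[symmetric]
        using c by algebra
    qed
    have split: "K * L / y / d * (U * V - W * Z / q * d) = U * K * (L * V / d) / y - W * L * (K * Z) / (q * y)"
      if "d \<noteq> 0" for d K L U V W Z :: complex
      using that y0 q by (simp add: field_simps)
    have "s k = A k * A (m - k) / y / (1 - q^2 * z^2) *
       (\<gamma> * (1 - b / q^2) * (1 - a * z^2) + (\<alpha> * y^2 + \<beta>) * (1 - q^2 * z^2))"
      unfolding s1 t1 using y0 D0 by (simp add: divide_simps) (simp add: algebra_simps power2_eq_square)
    also have "\<dots> = G k - G (Suc k)"
      unfolding poly G1 G2 using D0 by (rule split)
    finally show ?thesis .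
  qed
  have "\<gamma> * T = (\<Sum>k\<le>m. s k) - (\<alpha> + \<beta> * q / x) * N + G (Suc m)"
  proof -
    have e1: "(\<Sum>k\<le>m. q ^ k * A k * A (m - k)) = N"
      by (simp add: clausen_conv_def A_def N_def)
    have e2: "(\<Sum>k\<le>m. q ^ (m - k) * A k * A (m - k)) = N"
      by (simp add: clausen_conv_rev A_def N_def)
    \<comment> \<open>The separate last summand of \<open>T\<close> is the boundary term of the telescoping sum.\<close>
    have Gm: "G (Suc m) = \<gamma> * ((1 - a * b / q) * A (Suc m) / x)"
      by (simp add: G_def \<gamma>_def A_def x_def pow2 power_mult_distrib)
    have "(\<Sum>k\<le>m. s k) = \<gamma> * (1 - b / q^2) * sum t {..m} + (\<alpha> + \<beta> * q / x) * N"
      unfolding s_def sum.distrib sum_distrib_left[symmetric] e1 e2 by (simp add: distrib_right)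
    then show ?thesis
      unfolding Gm T_def A_def[symmetric] t_def[symmetric] by (simp add: algebra_simps)
  qed
  also have "(\<Sum>k\<le>m. s k) = G 0 - G (Suc m)"
    using sum_telescope[of G m] step by simp
  also have "G 0 = 0"
    by (simp add: G_def)
  finally have \<gamma>T: "\<gamma> * T = - (\<alpha> + \<beta> * q / x) * N"
    by (simp add: algebra_simps)
  have "\<gamma> * (q * x * T) = - (\<alpha> * x + \<beta> * q) * q * N"
  proof -
    have "x \<noteq> 0"
      using q by (simp add: x_def)
    then have "q * x * (\<alpha> + \<beta> * q / x) = (\<alpha> * x + \<beta> * q) * q"
      by (simp add: field_simps)
    then have "- (\<alpha> * x + \<beta> * q) * q * N = q * x * (- (\<alpha> + \<beta> * q / x) * N)"
      by (metis mult.assoc mult_minus_left mult_minus_right)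
    then show ?thesis
      unfolding \<gamma>T[symmetric] by (simp only: mult.left_commute)
  qed
  moreover have "\<gamma> = (1 + x) * ((1 - x) * (1 - a * b * x^2 / q))"
    by (simp add: \<gamma>_def algebra_simps power2_eq_square)
  moreover have "- (\<alpha> * x + \<beta> * q) * q = (1 + x) * ((1 - a * q ^ m) *
      (a * b * (x / q)^2 * (b - q^2) + a * b * q ^ m * (q - 1) + q - b))"
  proof -
    define c where "c = inverse q"
    have c: "q * c = 1"
      using q by (simp add: c_def)
    have qm: "q ^ m = c * x"
      using q by (simp add: c_def x_def)
    show ?thesis
      unfolding \<alpha>_def \<beta>_def \<mu>_def qm divide_inverse inverse_mult_distrib power_inverse[symmetric] c_def[symmetric]
      using c by algebra
  qed
  ultimately have "(1 + x) * ((1 - x) * (1 - a * b * x^2 / q) * (q * x * T)) = (1 + x) *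
      ((1 - a * q ^ m) * (a * b * (x / q)^2 * (b - q^2) + a * b * q ^ m * (q - 1) + q - b) * N)"
    by (simp only: mult.assoc)
  moreover have "1 + x \<noteq> 0"
  proof
    assume "1 + x = 0"
    then have "x = - 1"
      by (simp add: eq_neg_iff_add_eq_0 add.commute)
    then have "x^2 = 1"
      by simp
    then show False
      using nz(1)[of m] by (simp add: x_def pow2 power_mult_distrib)
  qed
  ultimately show ?thesis
    unfolding N_def by simp
qed

section \<open>The hypergeometric series\<close>

text \<open>
  With \<open>p = q\<^sup>2\<close>, \<open>B = b/p\<close>, \<open>C = ab/q\<close>, four of the parameters are \<open>p\<^bsup>1-n\<^esup>/c\<close> for
  \<open>c = p, C\<close> (upper) and \<open>c = a, B\<close> (lower), so reversal cancels everything in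
  \<open>poch_reverse\<close> that does not depend on \<open>c\<close> and leaves the power \<open>(aB/(pC))\<^sup>k\<close>, which
  together with the argument \<open>p\<^sup>k\<close> of the series is \<open>q\<^bsup>-k\<^esup>\<close>. For \<open>k < n\<close> the factor
  \<open>1 - C\<close> of \<open>(C; p)\<^sub>n\<close> cancels, for \<open>k = n\<close> it remains.
\<close>
lemma phi43_eq_sum:
  fixes q a b :: complex
  assumes q: "q \<noteq> 0" and a: "a \<noteq> 0" and b: "b \<noteq> 0"
    and nz: "poch (q^2) (q^2) (Suc m) \<noteq> 0" "poch (a * b * q) (q^2) (Suc m) \<noteq> 0"
      "poch a (q^2) (Suc m) \<noteq> 0" "poch (b / q^2) (q^2) (Suc m) \<noteq> 0"
  defines "n \<equiv> Suc m"
  shows "phi43 (q powi (- 2 * int n)) a b (q powi (3 - 2 * int n) / (a * b))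
           (q powi (2 - 2 * int n) / a) (q powi (4 - 2 * int n) / b) (a * b * q) (q^2) (q^2) =
     poch (q^2) (q^2) n * poch (a * b * q) (q^2) m / (poch a (q^2) n * poch (b / q^2) (q^2) n) *
     ((1 - b / q^2) * (\<Sum>k\<le>m. clausen_coeff a b q k * clausen_coeff a b q (m - k) *
        (1 - a * (q^2) ^ (m - k)) / (1 - q^2 * (q^2) ^ (m - k)) / q ^ k)
     + (1 - a * b / q) * clausen_coeff a b q n / q ^ n)"
proof -
  define p where "p = q^2"
  define P where "P = p powi (1 - int n)"
  define B where "B = b / p"
  define C where "C = a * b / q"
  define A where "A = clausen_coeff a b q"
  define M where "M = poch p p n * poch (a * b * q) p m / (poch a p n * poch B p n)"
  define R where "R = (\<lambda>c k. \<Prod>i<k. 1 - c * p ^ (n - Suc i))"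
  define E where "E = (\<lambda>k. \<Prod>i<k. - (P * p ^ i))"
  define X where "X = (\<lambda>k. if k = n then 1 - C else (1 - B) * A (m - k) * (1 - a * p ^ (m - k)) / (1 - p * p ^ (m - k)))"
  have p0: "p \<noteq> 0" and B0: "B \<noteq> 0" and C0: "C \<noteq> 0"
    using q a b by (auto simp: p_def B_def C_def)
  have P_eq: "P = q powi (2 - 2 * int n)"
    using power_int_mult[of q 2 "1 - int n"] by (simp add: P_def p_def algebra_simps)
  have par1: "q powi (- 2 * int n) = P / p"
    unfolding P_eq p_def using q by (simp add: power_int_diff field_simps power_int_minus)
  have par2: "q powi (3 - 2 * int n) / (a * b) = P / C"
    unfolding P_eq C_def using q a b by (simp add: power_int_diff field_simps power3_eq_cube power2_eq_square)
  have par3: "q powi (4 - 2 * int n) / b = P / B"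
    unfolding P_eq B_def p_def using q b by (simp add: power_int_diff field_simps power4_eq_xxxx power2_eq_square)
  define tm where "tm = (\<lambda>k. poch (P / p) p k * poch a p k * poch b p k * poch (P / C) p k * p ^ k /
      (poch p p k * poch (P / a) p k * poch (P / B) p k * poch (a * b * q) p k))"
  have phi: "phi43 (q powi (- 2 * int n)) a b (q powi (3 - 2 * int n) / (a * b))
           (q powi (2 - 2 * int n) / a) (q powi (4 - 2 * int n) / b) (a * b * q) (q^2) (q^2) = (\<Sum>k. tm k)"
    unfolding par1 par2 par3 P_eq[symmetric] p_def[symmetric] phi43_def tm_def
    by (simp add: qpochs_def qpoch_eq_poch mult.assoc)
  have zero: "tm k = 0" if "k > n" for k
  proof -
    have "P / p * p ^ n = p powi (1 - int n + int n - 1)"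
      using p0 by (simp add: P_def power_int_add power_int_diff)
    then have "poch (P / p) p k = 0"
      using that by (auto simp: poch_eq_0_iff)
    then show ?thesis
      by (simp add: tm_def)
  qed
  have R_split: "poch c p (n - k) * R c k = poch c p n" if "k \<le> n" for c k
    using poch_split[OF that] by (simp add: R_def)
  have Rn0: "R c k \<noteq> 0" "poch c p (n - k) \<noteq> 0" if "k \<le> n" "poch c p n \<noteq> 0" for c k
    using R_split[OF that(1), of c] that(2) by auto
  have rev: "poch (P / c) p k = E k * R c k / c ^ k" if "k \<le> n" "c \<noteq> 0" for c k
    using poch_reverse[OF that p0] that(2) by (simp add: P_def E_def R_def nonzero_eq_divide_eq)
  have E0: "E k \<noteq> 0" for k
    using p0 by (simp add: E_def P_def)
  have nz': "poch p p n \<noteq> 0" "poch a p n \<noteq> 0" "poch B p n \<noteq> 0"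
    using nz by (simp_all add: n_def p_def B_def)
  have quot: "R p k * R C k / (R a k * R B k) = M * X k" if k: "k \<le> n" for k
  proof (cases "k = n")
    case True
    have "R C n = poch C p n"
      using R_split[of n C] by simp
    also have "\<dots> = (1 - C) * poch (a * b * q) p m"
      using q by (simp add: n_def poch_Suc_left C_def p_def power2_eq_square mult.assoc)
    finally show ?thesis
      using R_split[of n p] R_split[of n a] R_split[of n B] by (simp add: True M_def X_def)
  next
    case False
    with k have km: "k \<le> m"
      by (simp add: n_def)
    define j where "j = m - k"
    have nk: "n - k = Suc j"
      using km by (simp add: n_def j_def)
    have "R C k = (\<Prod>i<k. 1 - a * b * q * p ^ (m - Suc i))"
      unfolding R_def
    proof (intro prod.cong refl)
      fix i assume "i \<in> {..<k}"
      then have "n - Suc i = Suc (m - Suc i)"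
        using km by (simp add: n_def)
      then show "1 - C * p ^ (n - Suc i) = 1 - a * b * q * p ^ (m - Suc i)"
        using q by (simp add: C_def p_def power2_eq_square)
    qed
    then have RC: "poch (a * b * q) p j * R C k = poch (a * b * q) p m"
      using poch_split[OF km, of "a * b * q" p] by (simp add: j_def)
    have "poch (a * b * q) p m \<noteq> 0"
      using nz(2) by (simp add: poch_Suc p_def)
    with RC have ABj: "poch (a * b * q) p j \<noteq> 0"
      by auto
    have Rp: "R p k = poch p p n / (poch p p j * (1 - p * p ^ j))"
      using R_split[OF k, of p] Rn0[OF k nz'(1)] by (simp add: nk poch_Suc nonzero_eq_divide_eq ac_simps)
    have Ra: "R a k = poch a p n / (poch a p j * (1 - a * p ^ j))"
      using R_split[OF k, of a] Rn0[OF k nz'(2)] by (simp add: nk poch_Suc nonzero_eq_divide_eq ac_simps)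
    have RB: "R B k = poch B p n / ((1 - B) * poch b p j)"
      using R_split[OF k, of B] Rn0[OF k nz'(3)] p0 
      by (simp add: nk poch_Suc_left nonzero_eq_divide_eq ac_simps B_def)
    have RC': "R C k = poch (a * b * q) p m / poch (a * b * q) p j"
      using RC ABj by (simp add: nonzero_eq_divide_eq ac_simps)
    show ?thesis
      unfolding Rp Ra RB RC' using False
      by (simp add: M_def X_def A_def clausen_coeff_def p_def[symmetric] j_def[symmetric] ac_simps)
  qed
  have tm_eq: "tm k = M * (A k * X k / q ^ k)" if k: "k \<le> n" for k
  proof -
    have pw: "a ^ k * B ^ k * p ^ k / (p ^ k * C ^ k) = 1 / q ^ k"
    proof -
      have "a * B * p / (p * C) = 1 / q"
        using q a b p0 by (simp add: B_def C_def p_def field_simps power2_eq_square)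
      then have "(a * B * p / (p * C)) ^ k = (1 / q) ^ k"
        by simp
      then show ?thesis
        using p0 by (simp add: power_mult_distrib power_divide)
    qed
    have "tm k = A k * (R p k * R C k / (R a k * R B k)) * (a ^ k * B ^ k * p ^ k / (p ^ k * C ^ k))"
      unfolding tm_def rev[OF k p0] rev[OF k C0] rev[OF k a] rev[OF k B0] A_def clausen_coeff_def p_def[symmetric]
      using E0[of k] by (simp add: ac_simps)
    also have "\<dots> = M * (A k * X k / q ^ k)"
      unfolding quot[OF k] pw by simp
    finally show ?thesis .
  qed
  have "(\<Sum>k. tm k) = (\<Sum>k\<le>n. tm k)"
    using zero by (intro suminf_finite) auto
  also have "\<dots> = M * (\<Sum>k\<le>n. A k * X k / q ^ k)"
    using tm_eq by (simp add: sum_distrib_left)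
  also have "(\<Sum>k\<le>n. A k * X k / q ^ k) = (\<Sum>k\<le>m. A k * X k / q ^ k) + (1 - C) * A n / q ^ n"
    by (simp add: n_def X_def)
  also have "(\<Sum>k\<le>m. A k * X k / q ^ k) = (1 - B) * (\<Sum>k\<le>m. A k * A (m - k) *
        (1 - a * p ^ (m - k)) / (1 - p * p ^ (m - k)) / q ^ k)"
    unfolding sum_distrib_left by (intro sum.cong refl) (auto simp: X_def n_def ac_simps)
  finally show ?thesis
    unfolding phi by (simp only: M_def A_def p_def B_def C_def)
qed

theorem mainTheorem1:
  fixes n :: nat and q a b :: complex
  assumes "q \<noteq> 0" and "a \<noteq> 0" and "b \<noteq> 0"
    and "\<And>k. k \<le> n \<Longrightarrow>
      qpochs [q^2, q powi (2 - 2 * int n) / a, q powi (4 - 2 * int n) / b, a * b * q] (q^2) (int k) \<noteq> 0"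
    and "1 - a * b * q powi (2 * int n - 1) \<noteq> 0"
    and "qpoch (a * b) q (int n - 1) \<noteq> 0"
    and "qpochs [a, b / q^2] (q^2) (int n) \<noteq> 0"
    and "n = 0 \<Longrightarrow> 1 - b / q \<noteq> 0"
    and "n = 0 \<Longrightarrow> 1 - a * b / q^2 \<noteq> 0"
  shows "phi43 (q powi (- 2 * int n)) a b (q powi (3 - 2 * int n) / (a * b))
           (q powi (2 - 2 * int n) / a) (q powi (4 - 2 * int n) / b) (a * b * q) (q^2) (q^2) =
         qpochs [a, - q] q (int n) * qpoch b q (int n - 1) * qpoch (a * b) (q^2) (int n - 1) *
           (a * b * q powi (2 * int n - 2) * (b - q^2) + a * b * q powi (int n - 1) * (q - 1) + q - b) /
         (q ^ (n + 1) * (1 - a * b * q powi (2 * int n - 1)) * qpoch (a * b) q (int n - 1) *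
           qpochs [a, b / q^2] (q^2) (int n))"
proof (cases n)
  case 0
  \<comment> \<open>The indices \<open>-1\<close> occur here: the inverted factors cancel against the factorization of the bracket.\<close>
  have "poch 1 p k = 0" if "k > 0" for p k
    using that by (auto simp: poch_eq_0_iff)
  then have "phi43 1 a b c d e f (q^2) (q^2) = 1" for c d e f
    unfolding phi43_def qpochs_def qpoch_eq_poch by (subst suminf_finite[of "{0}"]) auto
  moreover have "a * b * q powi (- 2) * (b - q^2) + a * b * q powi (- 1) * (q - 1) + q - b
      = q * (1 - b / q) * (1 - a * b / q^2)"
    using assms(1) by (simp add: power_int_minus field_simps power2_eq_square)
  moreover have "1 - a * b / q \<noteq> 0"
    using assms(5) 0 by (simp add: power_int_minus divide_inverse)
  ultimately show ?thesis
    using assms(1,8,9) 0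
    by (simp add: qpochs_def qpoch_def power_int_minus divide_inverse[symmetric])
next
  case (Suc m)
  define x where "x = q ^ n"
  define f where "f = a * b * (x / q)^2 * (b - q^2) + a * b * q ^ m * (q - 1) + q - b"
  have q: "q \<noteq> 0" and a: "a \<noteq> 0" and b: "b \<noteq> 0"
    using assms by simp_all
  have nz: "poch (q^2) (q^2) n \<noteq> 0" "poch (a * b * q) (q^2) n \<noteq> 0"
      "poch a (q^2) n \<noteq> 0" "poch (b / q^2) (q^2) n \<noteq> 0" "poch (a * b) q m \<noteq> 0"
    subgoal using assms(4)[of n] by (simp add: qpochs_def qpoch_eq_poch)
    subgoal using assms(4)[of n] by (simp add: qpochs_def qpoch_eq_poch)
    subgoal using assms(7) by (simp add: qpochs_def qpoch_eq_poch)
    subgoal using assms(7) by (simp add: qpochs_def qpoch_eq_poch)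
    subgoal using assms(6) by (simp add: Suc qpoch_eq_poch)
    done
  have nzp: "1 - q^2 * (q^2) ^ k \<noteq> 0" "1 - a * b * q * (q^2) ^ k \<noteq> 0" if "k \<le> m" for k
    using nz(1,2) that by (auto simp: poch_eq_0_iff Suc less_Suc_eq_le)
  have pows: "q powi (2 * int n - 1) = x^2 / q" "q powi (2 * int n - 2) = (x / q)^2"
      "q powi (int n - 1) = q ^ m"
    using q by (simp_all add: x_def power_int_diff power_divide Suc power_int_mult power2_eq_square power_int_add power_mult_distrib)
  have x1: "1 - x \<noteq> 0" and qq: "poch q q m \<noteq> 0"
    using nz(1) unfolding poch_square by (auto simp: Suc poch_Suc x_def)
  have w: "1 - a * b * x^2 / q \<noteq> 0"
    using assms(5) by (simp add: pows)
  have abq: "poch (a * b * q) (q^2) m \<noteq> 0" "poch (q^2) (q^2) m \<noteq> 0"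
    using nz(1,2) by (auto simp: Suc poch_Suc)
  define T where "T = (1 - b / q^2) * (\<Sum>k\<le>m. clausen_coeff a b q k * clausen_coeff a b q (m - k) *
        (1 - a * (q^2) ^ (m - k)) / (1 - q^2 * (q^2) ^ (m - k)) / q ^ k)
     + (1 - a * b / q) * clausen_coeff a b q n / q ^ n"
  have "(1 - x) * (1 - a * b * x^2 / q) * (q * x * T) = (1 - a * q ^ m) * f * clausen_conv a b q m"
    unfolding f_def T_def x_def Suc by (rule contiguous_sum[OF q nzp]) 
  then have T: "T = (1 - a * q ^ m) * f * clausen_conv a b q m / ((1 - x) * (1 - a * b * x^2 / q) * (q * x))"
    using x1 w q by (simp add: nonzero_eq_divide_eq x_def ac_simps)
  have p2: "poch (q^2) (q^2) n = poch q q m * (1 - x) * poch (- q) q n"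
  proof -
    have "poch q q n = poch q q m * (1 - x)"
      by (simp add: Suc poch_Suc x_def)
    then show ?thesis
      by (simp add: poch_square)
  qed
  have "phi43 (q powi (- 2 * int n)) a b (q powi (3 - 2 * int n) / (a * b))
           (q powi (2 - 2 * int n) / a) (q powi (4 - 2 * int n) / b) (a * b * q) (q^2) (q^2) =
     poch (q^2) (q^2) n * poch (a * b * q) (q^2) m / (poch a (q^2) n * poch (b / q^2) (q^2) n) * T"
    unfolding T_def Suc by (rule phi43_eq_sum) (use q a b nz in \<open>auto simp: Suc\<close>)
  also have "\<dots> = poch a q n * poch (- q) q n * poch b q m * poch (a * b) (q^2) m * f /
      (q * x * (1 - a * b * x^2 / q) * poch (a * b) q m * (poch a (q^2) n * poch (b / q^2) (q^2) n))"
  proof -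
    have an: "poch a q n = poch a q m * (1 - a * q ^ m)"
      by (simp add: Suc poch_Suc)
    show ?thesis
      unfolding T clausen_conv_closed_form[OF q abq(2,1) nz(5)] p2 an
      using x1 qq abq by (simp add: ac_simps)
  qed
  finally have eq: "phi43 (q powi (- 2 * int n)) a b (q powi (3 - 2 * int n) / (a * b))
           (q powi (2 - 2 * int n) / a) (q powi (4 - 2 * int n) / b) (a * b * q) (q^2) (q^2) =
      poch a q n * poch (- q) q n * poch b q m * poch (a * b) (q^2) m * f /
      (q * x * (1 - a * b * x^2 / q) * poch (a * b) q m * (poch a (q^2) n * poch (b / q^2) (q^2) n))" .
  have "int n - 1 = int m"
    by (simp add: Suc)
  then show ?thesis
    unfolding eq pows by (simp add: qpochs_def qpoch_eq_poch f_def x_def mult.assoc)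
qed

end
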